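(* Let $n\geq 4$ be a natural number and let $G:=SD_n$ be the semidihedral group of order $2^n$. Then $$\Delta(G)=\begin{cases} 2 & \text{if } n=4,\\ 3 & \text{if } n\geq 5.\end{cases}$$
   Context: For $n\ge 4$, $SD_n:=\langle a,b\mid a^{2^{n-1}}=1=b^2,\ a^b=a^{-1+2^{n-2}}\rangle$, where $a^b=b^{-1}ab$; this is the semidihedral group of order $2^n$. A subset $S$ of a group $G$ normally generates $G$ if $G$ is the normal closure of $S$ in $G$ (the smallest normal subgroup of $G$ containing $S$). Put $\mathrm{Conj}_G(S^{\pm1})=\{h^{-1}sh\mid h\in G,\ s\in S\text{ or }s^{-1}\in S\}$. If $S$ normally generates $G$, then for $g\in G$ let $\|g\|_S$ be the least $k\in\{0,1,2,\dots\}$ such that $g$ is a product of $k$ elements of $\mathrm{Conj}_G(S^{\pm1})$ (so $\|1\|_S=0$), and let $\|G\|_S=\sup\{\|g\|_S\mid g\in G\}$. The conjugacy diameter of $G$ is $\Delta(G)=\sup\{\|G\|_S\mid S\subseteq G\text{ finite and } S \text{ normally generates } G\}$. *)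

theory Defs
  imports "HOL-Algebra.Algebra" "HOL-Library.Extended_Nat"
begin

section \<open>Normal closure\<close>

definition normal_closure :: "('a, 'b) monoid_scheme \<Rightarrow> 'a set \<Rightarrow> 'a set" where
  "normal_closure G S = \<Inter>{N. N \<lhd> G \<and> S \<subseteq> N}"

lemma (in group) normal_closure_normal:
  assumes "S \<subseteq> carrier G"
  shows "normal_closure G S \<lhd> G"
proof -
  let ?\<N> = "{N. N \<lhd> G \<and> S \<subseteq> N}"
  have carr: "carrier G \<in> ?\<N>"
    using assms by (auto simp: normal_inv_iff subgroup_self)
  have "subgroup (\<Inter>?\<N>) G"
    by (rule subgroups_Inter) (use carr in \<open>auto dest: normal_imp_subgroup\<close>)
  moreover have "x \<otimes> h \<otimes> inv x \<in> \<Inter>?\<N>" if "x \<in> carrier G" "h \<in> \<Inter>?\<N>" for x h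
    using that by (auto dest: normal.inv_op_closed2)
  ultimately show ?thesis
    unfolding normal_closure_def by (simp add: normal_inv_iff)
qed

section \<open>Free groups\<close>

text \<open>
  A word is a list of letters \<open>(x, e)\<close>, where \<open>(x, True)\<close> stands for the generator \<open>x\<close>
  and \<open>(x, False)\<close> for its formal inverse. The free group on the type of generators consists of
  the classes of words modulo insertion and deletion of factors \<open>x x\<inverse>\<close> and \<open>x\<inverse> x\<close>.
\<close>

inductive word_eq :: "('x \<times> bool) list \<Rightarrow> ('x \<times> bool) list \<Rightarrow> bool" where
  cancel: "word_eq (u @ [(x, e), (x, \<not> e)] @ v) (u @ v)"
| refl: "word_eq u u"
| sym: "word_eq u v \<Longrightarrow> word_eq v u"
| trans: "word_eq u v \<Longrightarrow> word_eq v w \<Longrightarrow> word_eq u w"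

definition word_class :: "('x \<times> bool) list \<Rightarrow> ('x \<times> bool) list set" where
  "word_class u = {v. word_eq u v}"

definition free_group :: "('x \<times> bool) list set monoid" where
  "free_group =
    \<lparr>carrier = range word_class,
     monoid.mult = (\<lambda>A B. \<Union>u\<in>A. \<Union>v\<in>B. word_class (u @ v)),
     one = word_class []\<rparr>"

definition free_gen :: "'x \<Rightarrow> ('x \<times> bool) list set" where
  "free_gen x = word_class [(x, True)]"

lemma word_class_eq_iff: "word_class u = word_class v \<longleftrightarrow> word_eq u v"
proof
  assume "word_class u = word_class v"
  then show "word_eq u v"
    using word_eq.refl[of v] by (simp add: word_class_def set_eq_iff)
next
  assume "word_eq u v"
  then show "word_class u = word_class v"
    unfolding word_class_def
    using word_eq.trans[of u v] word_eq.trans[of v u] word_eq.sym[of u v] by auto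
qed

lemma word_eq_append:
  assumes "word_eq u u'" "word_eq v v'"
  shows "word_eq (u @ v) (u' @ v')"
proof -
  have "word_eq (p @ u @ q) (p @ u' @ q)" if "word_eq u u'" for p q u u' :: "('a \<times> bool) list"
    using that
  proof induction
    case (cancel u x e v)
    show ?case using word_eq.cancel[of "p @ u" x e "v @ q"] by simp
  next
    case (refl u)
    show ?case by (rule word_eq.refl)
  next
    case (sym u v)
    show ?case by (rule word_eq.sym) (rule sym.IH)
  next
    case (trans u v w)
    show ?case by (rule word_eq.trans) (rule trans.IH)+
  qed
  from this[OF assms(1), of "[]" v] this[OF assms(2), of u' "[]"] show ?thesis
    by (simp add: word_eq.trans[of "u @ v" "u' @ v"])
qed

lemma free_group_mult:
  "word_class u \<otimes>\<^bsub>free_group\<^esub> word_class v = word_class (u @ v)"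
proof -
  have *: "word_class (u' @ v') = word_class (u @ v)" if "u' \<in> word_class u" "v' \<in> word_class v" for u' v'
  proof -
    have "word_eq u u'" "word_eq v v'"
      using that by (simp_all add: word_class_def)
    then show ?thesis
      unfolding word_class_eq_iff by (intro word_eq.sym[OF word_eq_append])
  qed
  have mem: "w \<in> word_class w" for w :: "('a \<times> bool) list"
    by (simp add: word_class_def word_eq.refl)
  have "(\<Union>u'\<in>word_class u. \<Union>v'\<in>word_class v. word_class (u' @ v')) = word_class (u @ v)"
    (is "?L = ?R")
  proof
    show "?L \<subseteq> ?R" using * by blast
    show "?R \<subseteq> ?L" using mem by blast
  qed
  then show ?thesis by (simp add: free_group_def)
qed

lemma word_eq_inverse:
  "word_eq (rev (map (\<lambda>(x, e). (x, \<not> e)) u) @ u) []"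
proof (induction u)
  case (Cons l u)
  obtain x e where l: "l = (x, e)" by force
  show ?case
    using word_eq.trans[OF word_eq.cancel[of "rev (map (\<lambda>(x, e). (x, \<not> e)) u)" x "\<not> e" u] Cons]
    by (simp add: l)
qed (simp add: word_eq.refl)

lemma group_free_group: "group free_group"
proof (rule groupI)
  fix A :: "('x \<times> bool) list set" assume "A \<in> carrier free_group"
  then obtain u where A: "A = word_class u" by (auto simp: free_group_def)
  let ?B = "word_class (rev (map (\<lambda>(x, e). (x, \<not> e)) u))"
  have "?B \<otimes>\<^bsub>free_group\<^esub> A = \<one>\<^bsub>free_group\<^esub>"
    using word_eq_inverse[of u]
    by (simp add: A free_group_mult) (simp add: free_group_def word_class_eq_iff)
  then show "\<exists>B\<in>carrier free_group. B \<otimes>\<^bsub>free_group\<^esub> A = \<one>\<^bsub>free_group\<^esub>"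
    by (rule bexI) (simp add: free_group_def)
next
  fix A :: "('x \<times> bool) list set" assume "A \<in> carrier free_group"
  then show "\<one>\<^bsub>free_group\<^esub> \<otimes>\<^bsub>free_group\<^esub> A = A"
    using free_group_mult[of "[]"] by (auto simp: free_group_def)
next
  fix A B :: "('x \<times> bool) list set"
  assume "A \<in> carrier free_group" "B \<in> carrier free_group"
  then obtain u v where "A = word_class u" "B = word_class v" by (auto simp: free_group_def)
  then show "A \<otimes>\<^bsub>free_group\<^esub> B \<in> carrier free_group"
    by (simp add: free_group_mult) (simp add: free_group_def)
next
  fix A B C :: "('x \<times> bool) list set"
  assume "A \<in> carrier free_group" "B \<in> carrier free_group" "C \<in> carrier free_group"
  then obtain u v w where "A = word_class u" "B = word_class v" "C = word_class w"
    by (auto simp: free_group_def)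
  then show "A \<otimes>\<^bsub>free_group\<^esub> B \<otimes>\<^bsub>free_group\<^esub> C = A \<otimes>\<^bsub>free_group\<^esub> (B \<otimes>\<^bsub>free_group\<^esub> C)"
    by (simp add: free_group_mult)
qed (simp add: free_group_def)

lemma free_gen_closed: "free_gen x \<in> carrier free_group"
  by (simp add: free_gen_def free_group_def)

section \<open>Group presentations\<close>

text \<open>
  The group presented by a set of equations \<open>u = v\<close> between elements of the free group:
  the quotient by the normal closure of all \<open>u v\<inverse>\<close>.
\<close>

definition presented_group ::
    "(('x \<times> bool) list set \<times> ('x \<times> bool) list set) set \<Rightarrow> ('x \<times> bool) list set set monoid" where
  "presented_group R =
    free_group Mod normal_closure free_group
      {u \<otimes>\<^bsub>free_group\<^esub> inv\<^bsub>free_group\<^esub> v | u v. (u, v) \<in> R}"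

lemma group_presented_group:
  assumes "R \<subseteq> carrier free_group \<times> carrier free_group"
  shows "group (presented_group R)"
proof -
  interpret F: group free_group by (rule group_free_group)
  show ?thesis
    unfolding presented_group_def
    by (intro normal.factorgroup_is_group F.normal_closure_normal) (use assms in auto)
qed

datatype sd_gen = Gen_a | Gen_b

definition SD :: "nat \<Rightarrow> (sd_gen \<times> bool) list set set monoid" where
  "SD n = (let F = free_group; a = free_gen Gen_a; b = free_gen Gen_b in
    presented_group
     {(a [^]\<^bsub>F\<^esub> (2 ^ (n - 1) :: nat), \<one>\<^bsub>F\<^esub>),
      (\<one>\<^bsub>F\<^esub>, b [^]\<^bsub>F\<^esub> (2 :: nat)),
      (inv\<^bsub>F\<^esub> b \<otimes>\<^bsub>F\<^esub> a \<otimes>\<^bsub>F\<^esub> b, a [^]\<^bsub>F\<^esub> (- 1 + 2 ^ (n - 2) :: int))})"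

lemma group_SD: "group (SD n)"
proof -
  interpret F: group "free_group :: (sd_gen \<times> bool) list set monoid" by (rule group_free_group)
  show ?thesis
    unfolding SD_def Let_def
    by (intro group_presented_group) (auto simp: free_gen_closed)
qed

section \<open>Conjugacy diameter\<close>

definition normally_generates :: "('a, 'b) monoid_scheme \<Rightarrow> 'a set \<Rightarrow> bool" where
  "normally_generates G S \<longleftrightarrow> S \<subseteq> carrier G \<and> normal_closure G S = carrier G"

definition Conj_pm :: "('a, 'b) monoid_scheme \<Rightarrow> 'a set \<Rightarrow> 'a set" where
  "Conj_pm G S = {inv\<^bsub>G\<^esub> h \<otimes>\<^bsub>G\<^esub> s \<otimes>\<^bsub>G\<^esub> h | h s.
     h \<in> carrier G \<and> s \<in> carrier G \<and> (s \<in> S \<or> inv\<^bsub>G\<^esub> s \<in> S)}"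

definition is_product_of :: "('a, 'b) monoid_scheme \<Rightarrow> 'a set \<Rightarrow> nat \<Rightarrow> 'a \<Rightarrow> bool" where
  "is_product_of G C k g \<longleftrightarrow>
     (\<exists>xs. length xs = k \<and> set xs \<subseteq> C \<and> g = foldr (\<otimes>\<^bsub>G\<^esub>) xs \<one>\<^bsub>G\<^esub>)"

text \<open>Meaningful only if \<open>S\<close> normally generates \<open>G\<close>, which guarantees that such a \<open>k\<close> exists.\<close>

definition conj_norm :: "('a, 'b) monoid_scheme \<Rightarrow> 'a set \<Rightarrow> 'a \<Rightarrow> nat" where
  "conj_norm G S g = (LEAST k. is_product_of G (Conj_pm G S) k g)"

text \<open>The suprema below may be infinite for a general group, hence the values in \<open>enat\<close>.\<close>

definition conj_norm_group :: "('a, 'b) monoid_scheme \<Rightarrow> 'a set \<Rightarrow> enat" where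
  "conj_norm_group G S = (SUP g\<in>carrier G. enat (conj_norm G S g))"

definition conjugacy_diameter :: "('a, 'b) monoid_scheme \<Rightarrow> enat" where
  "conjugacy_diameter G = (SUP S\<in>{S. finite S \<and> normally_generates G S}. conj_norm_group G S)"

end

theory Submission
  imports Defs "HOL-Number_Theory.Cong"
begin

text \<open>
  Write \<open>c = 2\<^bsup>n-2\<^esup> - 1\<close>. Every element of the group has a unique form \<open>a\<^sup>i b\<^sup>e\<close>, and the conjugacy
  classes are \<open>{a\<^sup>i, a\<^bsup>ci\<^esup>}\<close> and the two classes of reflections \<open>a\<^sup>j b\<close> with \<open>j\<close> even and with \<open>j\<close> odd.
  A normally generating set is contained in none of the three maximal subgroups, so it contains a
  reflection \<open>a\<^sup>i b\<close> and either a reflection of the other parity or some \<open>a\<^sup>k\<close> with \<open>k\<close> odd.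
  Products of two reflections from one class give all even powers of \<open>a\<close>. With both classes, two
  factors always suffice. With one class and \<open>a\<^sup>k\<close>, only odd powers of \<open>a\<close> can need three factors, and
  they do need three unless they are among the at most four conjugates of \<open>a\<^sup>k\<close> and \<open>a\<^bsup>-k\<^esup>\<close>.
  For \<open>n = 4\<close> these four are all the odd powers; for \<open>n \<ge> 5\<close> and \<open>S = {a, b}\<close> they do not
  include \<open>a\<^sup>3\<close>.
\<close>

section \<open>Homomorphisms out of free and presented groups\<close>

definition word_eval :: "('a, 'b) monoid_scheme \<Rightarrow> ('x \<Rightarrow> 'a) \<Rightarrow> ('x \<times> bool) list \<Rightarrow> 'a" where
  "word_eval H f u =
    foldr (\<lambda>(x, e) h. (if e then f x else inv\<^bsub>H\<^esub> f x) \<otimes>\<^bsub>H\<^esub> h) u \<one>\<^bsub>H\<^esub>"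

context group
begin

lemma word_eval_closed:
  assumes "range f \<subseteq> carrier G"
  shows "word_eval G f u \<in> carrier G"
  unfolding word_eval_def by (induction u) (use assms in \<open>auto simp: image_subset_iff\<close>)

lemma word_eval_append:
  assumes "range f \<subseteq> carrier G"
  shows "word_eval G f (u @ v) = word_eval G f u \<otimes> word_eval G f v"
proof (induction u)
  case Nil
  then show ?case using word_eval_closed[OF assms, of v] by (simp add: word_eval_def)
next
  case (Cons l u)
  then show ?case
    using word_eval_closed[OF assms, of v] word_eval_closed[OF assms, of u] assms
    by (cases l) (auto simp: word_eval_def m_assoc image_subset_iff)
qed

lemma word_eval_word_eq:
  assumes "word_eq u v" "range f \<subseteq> carrier G"
  shows "word_eval G f u = word_eval G f v"
  using assms(1)
proof induction
  case (cancel u x e v)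
  have "word_eval G f [(x, e), (x, \<not> e)] = \<one>"
    using assms(2) by (cases e) (auto simp: word_eval_def image_subset_iff)
  then have "word_eval G f ([(x, e), (x, \<not> e)] @ v) = word_eval G f v"
    using word_eval_closed[OF assms(2)] by (simp add: word_eval_append[OF assms(2)] del: append_Cons)
  then show ?case by (simp add: word_eval_append[OF assms(2)])
qed auto

lemma free_group_universal:
  fixes f :: "'x \<Rightarrow> 'a"
  assumes f: "range f \<subseteq> carrier G"
  obtains h where "h \<in> hom free_group G" "\<And>x. h (free_gen x) = f x"
proof -
  \<comment> \<open>An element of the free group is a set of equivalent words. Evaluation is
    constant on it, so the image is a singleton and \<open>the_elem\<close> returns the common
    value.\<close>
  define h where "h A = the_elem (word_eval G f ` A)" for A
  have h: "h (word_class u) = word_eval G f u" for u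
  proof -
    have "word_eval G f ` word_class u = {word_eval G f u}"
      using word_eval_word_eq[OF _ f] by (auto simp: word_class_def intro: word_eq.refl)
    then show ?thesis by (simp add: h_def)
  qed
  show ?thesis
  proof
    show "h \<in> hom free_group G"
    proof (rule homI)
      fix A :: "('x \<times> bool) list set" assume "A \<in> carrier free_group"
      then show "h A \<in> carrier G"
        using word_eval_closed[OF f] h by (auto simp: free_group_def)
    next
      fix A B :: "('x \<times> bool) list set"
      assume "A \<in> carrier free_group" "B \<in> carrier free_group"
      then obtain u v where "A = word_class u" "B = word_class v"
        by (auto simp: free_group_def)
      then show "h (A \<otimes>\<^bsub>free_group\<^esub> B) = h A \<otimes> h B"
        by (simp add: free_group_mult h word_eval_append[OF f])
    qed
    show "h (free_gen x) = f x" for x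
      using f by (simp add: free_gen_def h word_eval_def image_subset_iff)
  qed
qed

end

text \<open>Peels one letter at a time off the left of a word. This later brings every element of
  \<open>SD n\<close> to normal form.\<close>

lemma free_group_induct [consumes 1, case_names one gen inv_gen]:
  assumes "A \<in> carrier free_group"
    and "P \<one>\<^bsub>free_group\<^esub>"
    and gen: "\<And>x B. B \<in> carrier free_group \<Longrightarrow> P B \<Longrightarrow> P (free_gen x \<otimes>\<^bsub>free_group\<^esub> B)"
    and inv_gen: "\<And>x B. B \<in> carrier free_group \<Longrightarrow> P B \<Longrightarrow> P (inv\<^bsub>free_group\<^esub> free_gen x \<otimes>\<^bsub>free_group\<^esub> B)"
  shows "P A"
proof -
  interpret F: group free_group by (rule group_free_group)
  obtain u where A: "A = word_class u" using assms(1) by (auto simp: free_group_def)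
  have "P (word_class u)"
  proof (induction u)
    case Nil
    then show ?case using assms(2) by (simp add: free_group_def)
  next
    case (Cons l u)
    obtain x e where l: "l = (x, e)" by force
    have carr: "word_class w \<in> carrier free_group" for w :: "('a \<times> bool) list"
      by (simp add: free_group_def)
    have "word_class [(x, False)] \<otimes>\<^bsub>free_group\<^esub> free_gen x = \<one>\<^bsub>free_group\<^esub>"
      using word_eq.cancel[of "[]" x False "[]"]
      by (simp add: free_gen_def free_group_mult) (simp add: free_group_def word_class_eq_iff)
    then have inv: "inv\<^bsub>free_group\<^esub> free_gen x = word_class [(x, False)]"
      by (rule F.inv_equality) (simp_all add: carr free_gen_closed)
    show ?case
      using gen[OF carr Cons, of x] inv_gen[OF carr Cons, of x]
      by (cases e) (simp_all add: l inv free_group_mult, simp add: free_gen_def free_group_mult)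
  qed
  then show ?thesis by (simp add: A)
qed

text \<open>The canonical projection from the free group to the presented group.\<close>

definition presented_class ::
    "(('x \<times> bool) list set \<times> ('x \<times> bool) list set) set \<Rightarrow> ('x \<times> bool) list set \<Rightarrow> ('x \<times> bool) list set set" where
  "presented_class R u =
    normal_closure free_group {u \<otimes>\<^bsub>free_group\<^esub> inv\<^bsub>free_group\<^esub> v | u v. (u, v) \<in> R} #>\<^bsub>free_group\<^esub> u"

lemma
  assumes "R \<subseteq> carrier free_group \<times> carrier free_group"
  shows presented_class_hom: "presented_class R \<in> hom free_group (presented_group R)"
    and presented_group_carrier: "carrier (presented_group R) = presented_class R ` carrier free_group"
    and presented_class_eq: "(u, v) \<in> R \<Longrightarrow> presented_class R u = presented_class R v"
proof -
  interpret F: group free_group by (rule group_free_group)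
  let ?U = "{u \<otimes>\<^bsub>free_group\<^esub> inv\<^bsub>free_group\<^esub> v | u v. (u, v) \<in> R}"
  let ?N = "normal_closure free_group ?U"
  have N: "?N \<lhd> free_group"
    by (rule F.normal_closure_normal) (use assms in auto)
  interpret N: normal ?N free_group by (rule N)
  show "presented_class R \<in> hom free_group (presented_group R)"
    using N.r_coset_hom_Mod by (simp add: presented_class_def[abs_def] presented_group_def)
  show "carrier (presented_group R) = presented_class R ` carrier free_group"
    by (simp add: presented_class_def[abs_def] presented_group_def carrier_FactGroup)
  assume uv: "(u, v) \<in> R"
  then have "u \<otimes>\<^bsub>free_group\<^esub> inv\<^bsub>free_group\<^esub> v \<in> ?N"
    unfolding normal_closure_def by blast
  then have "u \<in> ?N #>\<^bsub>free_group\<^esub> v"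
    using uv assms by (intro N.rcos_module_rev[OF F.is_group]) auto
  then show "presented_class R u = presented_class R v"
    unfolding presented_class_def
    using uv assms N.subgroup_axioms by (intro F.repr_independence[symmetric]) auto
qed

text \<open>Von Dyck's theorem: the relators lie in the kernel of \<open>h\<close>, which is normal
  and hence contains their normal closure, so \<open>h\<close> factors through the quotient.\<close>

lemma (in group) presented_group_universal:
  assumes R: "R \<subseteq> carrier free_group \<times> carrier free_group"
    and h: "h \<in> hom free_group G" "\<And>u v. (u, v) \<in> R \<Longrightarrow> h u = h v"
  obtains g where "g \<in> hom (presented_group R) G"
    "\<And>u. u \<in> carrier free_group \<Longrightarrow> g (presented_class R u) = h u"
proof -
  interpret F: group free_group by (rule group_free_group)
  interpret h: group_hom free_group G h
    by (simp add: group_hom_def group_hom_axioms_def F.is_group is_group h(1))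
  let ?U = "{u \<otimes>\<^bsub>free_group\<^esub> inv\<^bsub>free_group\<^esub> v | u v. (u, v) \<in> R}"
  have U: "?U \<subseteq> carrier free_group" using R by auto
  have "h (u \<otimes>\<^bsub>free_group\<^esub> inv\<^bsub>free_group\<^esub> v) = \<one>" if uv: "(u, v) \<in> R" for u v
  proof -
    have "u \<in> carrier free_group" "v \<in> carrier free_group" using R uv by auto
    then show ?thesis by (simp add: h(2)[OF uv])
  qed
  then have "?U \<subseteq> kernel free_group G h"
    using U unfolding kernel_def by blast
  then have "normal_closure free_group ?U \<subseteq> kernel free_group G h"
    unfolding normal_closure_def by (intro Inter_lower) (simp add: h.normal_kernel)
  from h.FactGroup_universal_kernel[OF F.normal_closure_normal[OF U] this] that
  show ?thesis unfolding presented_group_def presented_class_def by blast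
qed

section \<open>Normal form of the semidihedral group\<close>

definition sd_exp :: "nat \<Rightarrow> int" where
  "sd_exp n = 2 ^ (n - 2) - 1"

text \<open>Expresses that conjugating twice by \<open>b\<close> fixes \<open>a\<close>. The
  difference of the two sides is \<open>2^(2n-4) - 2^(n-1)\<close>, a multiple of
  \<open>2^(n-1)\<close>.\<close>

lemma sd_exp_square:
  assumes "n \<ge> 4"
  shows "[sd_exp n * sd_exp n = 1] (mod 2 ^ (n - 1))"
proof -
  \<comment> \<open>This substitution removes the truncated subtractions from the exponents.\<close>
  obtain k where n: "n = k + 4" using assms by (metis add.commute le_Suc_ex)
  have "sd_exp n * sd_exp n - 1 = 2 ^ (n - 1) * (2 ^ (n - 3) - 1)"
    by (simp add: sd_exp_def n power_add power2_eq_square algebra_simps)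
  then show ?thesis by (simp add: cong_iff_dvd_diff)
qed

lemma odd_sd_exp:
  assumes "n \<ge> 4"
  shows "odd (sd_exp n)"
  using assms by (simp add: sd_exp_def)

text \<open>The pair \<open>(i, e)\<close> stands for \<open>a\<^sup>i b\<^sup>e\<close>, so that multiplication uses \<open>b a\<^sup>j = a\<^bsup>cj\<^esup> b\<close> with \<open>c = 2\<^bsup>n-2\<^esup> - 1\<close>.\<close>

definition sd_model :: "nat \<Rightarrow> (int \<times> bool) monoid" where
  "sd_model n =
    \<lparr>carrier = {0..<2 ^ (n - 1)} \<times> UNIV,
     monoid.mult = (\<lambda>(i, e) (j, f). ((i + (if e then sd_exp n * j else j)) mod 2 ^ (n - 1), e \<noteq> f)),
     one = (0, False)\<rparr>"

text \<open>A semidirect product of the integers modulo \<open>2^(n-1)\<close> by a group of order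
  two acting through \<open>s\<close>. Associativity reduces to \<open>s\<close> being
  multiplicative, which is \<open>sd_exp_square\<close>.\<close>

lemma group_sd_model:
  assumes "n \<ge> 4"
  shows "group (sd_model n)"
proof -
  let ?c = "sd_exp n" and ?N = "2 ^ (n - 1) :: int"
  define s where "s e = (if e then ?c else 1)" for e
  have mult: "(i, e) \<otimes>\<^bsub>sd_model n\<^esub> (j, f) = ((i + s e * j) mod ?N, e \<noteq> f)" for i e j f
    by (simp add: sd_model_def s_def)
  have s_mult: "[s (e \<noteq> f) = s e * s f] (mod ?N)" for e f
    using cong_sym[OF sd_exp_square[OF assms]] by (cases e; cases f) (simp_all add: s_def)
  show ?thesis
  proof (rule groupI)
    fix x y z assume "x \<in> carrier (sd_model n)" "y \<in> carrier (sd_model n)" "z \<in> carrier (sd_model n)"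
    obtain i e j f k g where xyz: "x = (i, e)" "y = (j, f)" "z = (k, g)" by (metis surj_pair)
    have "[(i + s e * j) mod ?N + s (e \<noteq> f) * k = i + s e * j + s e * s f * k] (mod ?N)"
      by (intro cong_add cong_mult cong_refl s_mult) simp
    also have "i + s e * j + s e * s f * k = i + s e * (j + s f * k)" by (simp add: algebra_simps)
    also have "[\<dots> = i + s e * ((j + s f * k) mod ?N)] (mod ?N)"
      by (intro cong_add cong_mult cong_refl) (simp add: cong_def)
    finally show "x \<otimes>\<^bsub>sd_model n\<^esub> y \<otimes>\<^bsub>sd_model n\<^esub> z = x \<otimes>\<^bsub>sd_model n\<^esub> (y \<otimes>\<^bsub>sd_model n\<^esub> z)"
      unfolding cong_def by (simp only: xyz mult) auto
  next
    fix x assume x: "x \<in> carrier (sd_model n)"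
    obtain i e where i: "x = (i, e)" by force
    \<comment> \<open>The inverse of \<open>a^i b\<close> is
      \<open>b a^(-i) = a^(-ci) b\<close>.\<close>
    let ?y = "((if e then - ?c * i else - i) mod ?N, e)"
    have "?y \<otimes>\<^bsub>sd_model n\<^esub> x = \<one>\<^bsub>sd_model n\<^esub>"
      by (cases e) (simp_all add: sd_model_def i mod_simps)
    then show "\<exists>y\<in>carrier (sd_model n). y \<otimes>\<^bsub>sd_model n\<^esub> x = \<one>\<^bsub>sd_model n\<^esub>"
      by (rule bexI) (simp add: sd_model_def)
  qed (auto simp: sd_model_def)
qed

text \<open>Collects what the later arguments need about the group, so that they never touch words
  or cosets. The exponent \<open>i\<close> ranges over all integers, which avoids reducing it after
  each product.\<close>

locale semidihedral = group G for G (structure) +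
  fixes n :: nat and el :: "int \<Rightarrow> bool \<Rightarrow> 'a"
  assumes n: "n \<ge> 4"
    and carrier_eq: "carrier G = {el i e | i e. True}"
    and el_mult: "el i e \<otimes> el j f = el (i + (if e then sd_exp n * j else j)) (e \<noteq> f)"
    and el_eq_iff: "el i e = el j f \<longleftrightarrow> [i = j] (mod 2 ^ (n - 1)) \<and> e = f"

text \<open>The relations give the multiplication rule and show that every element has the form
  \<open>el i e\<close>. That distinct normal forms stay distinct is seen by mapping the group to
  \<open>sd_model n\<close>.\<close>

lemma SD_semidihedral:
  assumes n: "n \<ge> 4"
  obtains el where "semidihedral (SD n) n el"
proof -
  interpret F: group "free_group :: (sd_gen \<times> bool) list set monoid" by (rule group_free_group)
  interpret G: group "SD n" by (rule group_SD)
  interpret M: group "sd_model n" by (rule group_sd_model[OF n])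
  let ?F = "free_group :: (sd_gen \<times> bool) list set monoid"
  let ?c = "sd_exp n" and ?N = "2 ^ (n - 1) :: int"
  let ?a = "free_gen Gen_a" and ?b = "free_gen Gen_b"
  define R where "R = {(?a [^]\<^bsub>?F\<^esub> (2 ^ (n - 1) :: nat), \<one>\<^bsub>?F\<^esub>),
      (\<one>\<^bsub>?F\<^esub>, ?b [^]\<^bsub>?F\<^esub> (2 :: nat)),
      (inv\<^bsub>?F\<^esub> ?b \<otimes>\<^bsub>?F\<^esub> ?a \<otimes>\<^bsub>?F\<^esub> ?b, ?a [^]\<^bsub>?F\<^esub> (- 1 + 2 ^ (n - 2) :: int))}"
  have SD: "SD n = presented_group R" by (simp add: SD_def R_def Let_def)
  have R: "R \<subseteq> carrier ?F \<times> carrier ?F" by (auto simp: R_def free_gen_closed)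
  define p where "p = presented_class R"
  have p: "p \<in> hom ?F (SD n)" and surj: "carrier (SD n) = p ` carrier ?F"
    and p_eq: "\<And>u v. (u, v) \<in> R \<Longrightarrow> p u = p v"
    using presented_class_hom[OF R] presented_group_carrier[OF R] presented_class_eq[OF R]
    by (simp_all add: p_def SD)
  interpret p: group_hom ?F "SD n" p
    by (simp add: group_hom_def group_hom_axioms_def p F.is_group G.is_group)
  define a b where "a = p ?a" and "b = p ?b"
  have a: "a \<in> carrier (SD n)" and b: "b \<in> carrier (SD n)"
    by (simp_all add: a_def b_def free_gen_closed)
  have aN: "a [^]\<^bsub>SD n\<^esub> ?N = \<one>\<^bsub>SD n\<^esub>"
  proof -
    have "a [^]\<^bsub>SD n\<^esub> (2 ^ (n - 1) :: nat) = \<one>\<^bsub>SD n\<^esub>"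
      using p_eq[of "?a [^]\<^bsub>?F\<^esub> (2 ^ (n - 1) :: nat)" "\<one>\<^bsub>?F\<^esub>"]
      by (simp add: R_def a_def p.hom_nat_pow free_gen_closed)
    then show ?thesis using int_pow_int[of "SD n" a "2 ^ (n - 1)"] by simp
  qed
  have bb: "b \<otimes>\<^bsub>SD n\<^esub> b = \<one>\<^bsub>SD n\<^esub>"
    using p_eq[of "\<one>\<^bsub>?F\<^esub>" "?b [^]\<^bsub>?F\<^esub> (2 :: nat)"]
    by (simp add: R_def b_def p.hom_nat_pow free_gen_closed numeral_2_eq_2)
  then have inv_b: "inv\<^bsub>SD n\<^esub> b = b" using b by (simp add: G.inv_equality)
  have bab: "b \<otimes>\<^bsub>SD n\<^esub> a \<otimes>\<^bsub>SD n\<^esub> b = a [^]\<^bsub>SD n\<^esub> ?c"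
    using p_eq[of "inv\<^bsub>?F\<^esub> ?b \<otimes>\<^bsub>?F\<^esub> ?a \<otimes>\<^bsub>?F\<^esub> ?b" "?a [^]\<^bsub>?F\<^esub> (- 1 + 2 ^ (n - 2) :: int)"] inv_b
    by (simp add: R_def a_def b_def p.hom_int_pow free_gen_closed sd_exp_def)
  have conj: "b \<otimes>\<^bsub>SD n\<^esub> a [^]\<^bsub>SD n\<^esub> j = a [^]\<^bsub>SD n\<^esub> (?c * j) \<otimes>\<^bsub>SD n\<^esub> b" for j :: int
  proof -
    \<comment> \<open>Since \<open>b\<close> is its own inverse, \<open>?h\<close> is conjugation by
      \<open>b\<close>, so it sends \<open>a^j\<close> to the \<open>j\<close>-th power of
      \<open>a^c\<close>.\<close>
    let ?h = "\<lambda>x. b \<otimes>\<^bsub>SD n\<^esub> x \<otimes>\<^bsub>SD n\<^esub> b"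
    have bbx: "b \<otimes>\<^bsub>SD n\<^esub> (b \<otimes>\<^bsub>SD n\<^esub> x) = x" if "x \<in> carrier (SD n)" for x
      using that b bb by (simp flip: G.m_assoc)
    have "?h \<in> hom (SD n) (SD n)"
      by (rule homI) (use b bbx in \<open>simp_all add: G.m_assoc\<close>)
    then have "?h (a [^]\<^bsub>SD n\<^esub> j) = ?h a [^]\<^bsub>SD n\<^esub> j"
      using hom_int_pow[of ?h "SD n" "SD n" a j] a G.is_group by simp
    also have "\<dots> = a [^]\<^bsub>SD n\<^esub> (?c * j)"
      using a by (simp add: bab G.int_pow_pow)
    finally have "?h (a [^]\<^bsub>SD n\<^esub> j) \<otimes>\<^bsub>SD n\<^esub> b = a [^]\<^bsub>SD n\<^esub> (?c * j) \<otimes>\<^bsub>SD n\<^esub> b" by simp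
    then show ?thesis using a b bb by (simp add: G.m_assoc)
  qed
  define el where "el i e = a [^]\<^bsub>SD n\<^esub> i \<otimes>\<^bsub>SD n\<^esub> (if e then b else \<one>\<^bsub>SD n\<^esub>)" for i :: int and e
  have el_closed: "el i e \<in> carrier (SD n)" for i e using a b by (simp add: el_def)
  have el_mult: "el i e \<otimes>\<^bsub>SD n\<^esub> el j f = el (i + (if e then ?c * j else j)) (e \<noteq> f)" for i e j f
  proof -
    have "b \<otimes>\<^bsub>SD n\<^esub> (a [^]\<^bsub>SD n\<^esub> j \<otimes>\<^bsub>SD n\<^esub> b) = a [^]\<^bsub>SD n\<^esub> (?c * j)"
      using a b bb G.m_assoc[of b "a [^]\<^bsub>SD n\<^esub> j" b] by (simp add: conj G.m_assoc)
    then show ?thesis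
      using a b by (auto simp: el_def G.m_assoc conj G.int_pow_mult)
  qed
  have a_el: "a = el 1 False" and b_el: "b = el 0 True" and inv_a_el: "inv\<^bsub>SD n\<^esub> a = el (- 1) False"
    using a b by (auto simp: el_def G.int_pow_neg)
  have carrier: "carrier (SD n) = {el i e | i e. True}"
  proof -
    have "\<exists>i e. p A = el i e" if "A \<in> carrier ?F" for A
      using that
    proof (induction rule: free_group_induct)
      case one
      have "p \<one>\<^bsub>?F\<^esub> = el 0 False" by (simp add: el_def)
      then show ?case by blast
    next
      case (gen x B)
      then obtain i e where "p B = el i e" by blast
      moreover have "p (free_gen x) = (case x of Gen_a \<Rightarrow> el 1 False | Gen_b \<Rightarrow> el 0 True)"
        using a_el b_el by (cases x) (auto simp: a_def b_def)
      ultimately show ?case using gen by (cases x) (auto simp: free_gen_closed el_mult)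
    next
      case (inv_gen x B)
      then obtain i e where "p B = el i e" by blast
      moreover have "p (inv\<^bsub>?F\<^esub> free_gen x) = (case x of Gen_a \<Rightarrow> el (- 1) False | Gen_b \<Rightarrow> el 0 True)"
        using b_el inv_a_el inv_b by (cases x) (auto simp: a_def b_def free_gen_closed)
      ultimately show ?case using inv_gen by (cases x) (auto simp: free_gen_closed el_mult simp del: p.hom_inv)
    qed
    then show ?thesis using surj el_closed by auto
  qed
  have el_cong: "el i e = el j e" if ij: "[i = j] (mod ?N)" for i j e
  proof -
    obtain k where "i = j + ?N * k" using ij by (metis cong_iff_lin cong_sym)
    then have "a [^]\<^bsub>SD n\<^esub> i = a [^]\<^bsub>SD n\<^esub> j"
      using a aN by (simp add: G.int_pow_mult flip: G.int_pow_pow)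
    then show ?thesis by (simp add: el_def)
  qed
  \<comment> \<open>Next comes the homomorphism to the model with \<open>a\<close> going to
    \<open>(1, False)\<close> and \<open>b\<close> to \<open>(0, True)\<close>.\<close>
  have "range (case_sd_gen (1, False) (0, True)) \<subseteq> carrier (sd_model n)"
    using n by (simp add: sd_model_def image_subset_iff split: sd_gen.split)
  from M.free_group_universal[OF this] obtain q where q: "q \<in> hom ?F (sd_model n)"
    and q_gen: "\<And>x. q (free_gen x) = case_sd_gen (1, False) (0, True) x"
    by metis
  interpret q: group_hom ?F "sd_model n" q
    by (simp add: group_hom_def group_hom_axioms_def q F.is_group M.is_group)
  have M_one: "\<one>\<^bsub>sd_model n\<^esub> = (0, False)" by (simp add: sd_model_def)
  have M_mult: "(i, e) \<otimes>\<^bsub>sd_model n\<^esub> (j, f) = ((i + (if e then ?c * j else j)) mod ?N, e \<noteq> f)" for i e j f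
    by (simp add: sd_model_def)
  have N1: "?N > 1" using n by simp
  have M_carr: "(1, False) \<in> carrier (sd_model n)" "(0, True) \<in> carrier (sd_model n)"
    using N1 by (auto simp: sd_model_def)
  have pow_nat: "(1, False) [^]\<^bsub>sd_model n\<^esub> (k :: nat) = (int k mod ?N, False)" for k
    by (induction k) (simp_all add: M_one M_mult mod_simps add.commute)
  \<comment> \<open>The third relation carries an integer exponent, so natural powers alone do not
    suffice to check it in the model.\<close>
  have pow_int: "(1, False) [^]\<^bsub>sd_model n\<^esub> (k :: int) = (k mod ?N, False)" for k
  proof (cases "k \<ge> 0")
    case True
    then show ?thesis using pow_nat[of "nat k"] by (metis int_pow_int nat_0_le)
  next
    case False
    then have "(1, False) [^]\<^bsub>sd_model n\<^esub> k = inv\<^bsub>sd_model n\<^esub> ((1, False) [^]\<^bsub>sd_model n\<^esub> (nat (- k)))"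
      using M.int_pow_neg_int[OF M_carr(1), of "nat (- k)"] by simp
    also have "\<dots> = (k mod ?N, False)"
    proof (rule M.inv_equality)
      show "(k mod ?N, False) \<otimes>\<^bsub>sd_model n\<^esub> (1, False) [^]\<^bsub>sd_model n\<^esub> nat (- k) = \<one>\<^bsub>sd_model n\<^esub>"
        using False by (simp add: pow_nat M_mult M_one mod_simps)
      show "(1, False) [^]\<^bsub>sd_model n\<^esub> nat (- k) \<in> carrier (sd_model n)"
        by (rule M.nat_pow_closed[OF M_carr(1)])
    qed (simp add: sd_model_def)
    finally show ?thesis .
  qed
  have qR: "q u = q v" if uv: "(u, v) \<in> R" for u v
  proof -
    have inv_b: "inv\<^bsub>sd_model n\<^esub> (0, True) = (0, True)"
      by (rule M.inv_equality) (simp_all add: M_mult M_one M_carr)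
    have "q (?a [^]\<^bsub>?F\<^esub> (2 ^ (n - 1) :: nat)) = q \<one>\<^bsub>?F\<^esub>"
      by (simp add: q.hom_nat_pow free_gen_closed q_gen pow_nat M_one)
    moreover have "q \<one>\<^bsub>?F\<^esub> = q (?b [^]\<^bsub>?F\<^esub> (2 :: nat))"
      by (simp add: q.hom_nat_pow free_gen_closed q_gen M_one numeral_2_eq_2 M_mult)
    moreover have "q (inv\<^bsub>?F\<^esub> ?b \<otimes>\<^bsub>?F\<^esub> ?a \<otimes>\<^bsub>?F\<^esub> ?b) = q (?a [^]\<^bsub>?F\<^esub> (- 1 + 2 ^ (n - 2) :: int))"
      by (simp add: q.hom_int_pow free_gen_closed q_gen M_mult inv_b pow_int sd_exp_def)
    ultimately show ?thesis using uv by (auto simp: R_def)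
  qed
  obtain g where g: "g \<in> hom (SD n) (sd_model n)" "\<And>u. u \<in> carrier ?F \<Longrightarrow> g (p u) = q u"
    using M.presented_group_universal[OF R q qR] unfolding SD p_def by blast
  interpret g: group_hom "SD n" "sd_model n" g
    by (simp add: group_hom_def group_hom_axioms_def g G.is_group M.is_group)
  \<comment> \<open>The image determines \<open>e\<close> and \<open>i\<close> modulo
    \<open>2^(n-1)\<close>, so no two normal forms collapse.\<close>
  have g_el: "g (el i e) = (i mod ?N, e)" for i e
    using a b by (simp add: el_def g.hom_int_pow)
      (simp add: a_def b_def g(2) free_gen_closed q_gen pow_int M_mult M_one)
  have "semidihedral (SD n) n el"
  proof unfold_locales
    show "(el i e = el j f) = ([i = j] (mod ?N) \<and> e = f)" for i e j f
      using g_el[of i e] g_el[of j f] el_cong[of i j e] by (auto simp: cong_def)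
  qed (use n carrier el_mult in simp_all)
  then show ?thesis by (rule that)
qed

section \<open>Conjugates and word lengths\<close>

lemma conj_norm_le: "is_product_of G (Conj_pm G S) k g \<Longrightarrow> conj_norm G S g \<le> k"
  by (simp add: conj_norm_def Least_le)

lemma is_product_of_0: "is_product_of G C 0 g \<longleftrightarrow> g = \<one>\<^bsub>G\<^esub>"
  by (auto simp: is_product_of_def)

lemma is_product_of_Suc:
  "is_product_of G C (Suc k) g \<longleftrightarrow> (\<exists>x\<in>C. \<exists>h. is_product_of G C k h \<and> g = x \<otimes>\<^bsub>G\<^esub> h)"
  by (fastforce simp: is_product_of_def length_Suc_conv)

lemma (in group) Conj_pmI: "s \<in> S \<Longrightarrow> s \<in> carrier G \<Longrightarrow> h \<in> carrier G \<Longrightarrow> inv h \<otimes> s \<otimes> h \<in> Conj_pm G S"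
  unfolding Conj_pm_def by blast

lemma (in group) Conj_pm_invI:
  "s \<in> S \<Longrightarrow> s \<in> carrier G \<Longrightarrow> h \<in> carrier G \<Longrightarrow> inv h \<otimes> inv s \<otimes> h \<in> Conj_pm G S"
  unfolding Conj_pm_def by force

lemma (in group) Conj_pm_closed: "Conj_pm G S \<subseteq> carrier G"
  by (auto simp: Conj_pm_def)

lemma (in group) is_product_of_Conj_pm_1:
  "is_product_of G (Conj_pm G S) 1 g \<longleftrightarrow> g \<in> Conj_pm G S"
  unfolding One_nat_def is_product_of_Suc is_product_of_0
  using Conj_pm_closed by (metis r_one subsetD)

lemma (in group) is_product_of_Conj_pm_2:
  "is_product_of G (Conj_pm G S) 2 g \<longleftrightarrow> (\<exists>x\<in>Conj_pm G S. \<exists>y\<in>Conj_pm G S. g = x \<otimes> y)"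
  unfolding numeral_2_eq_2 is_product_of_Suc[of _ _ "Suc 0"]
  using is_product_of_Conj_pm_1 by auto

section \<open>Calculation in normal form\<close>

context semidihedral
begin

abbreviation c :: int where "c \<equiv> sd_exp n"
abbreviation N :: int where "N \<equiv> 2 ^ (n - 1)"

lemma el_closed [simp]: "el i e \<in> carrier G"
  using carrier_eq by blast

lemma carrierE:
  assumes "x \<in> carrier G"
  obtains i e where "x = el i e"
  using assms carrier_eq by blast

lemma odd_c: "odd c"
  by (rule odd_sd_exp) (rule n)

lemma even_N: "even N"
  using n by simp

lemma one_eq: "\<one> = el 0 False"
proof -
  have "el 0 False \<otimes> el 0 False = el 0 False" by (simp add: el_mult)
  then show ?thesis by (simp add: l_cancel_one[of "el 0 False" "el 0 False"])
qed

lemma inv_el: "inv (el i e) = el (if e then - c * i else - i) e"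
  by (rule inv_equality) (auto simp: el_mult one_eq)

text \<open>The conjugacy classes can be read off: a rotation exponent is kept or multiplied by
  \<open>c\<close>, and a reflection exponent keeps its parity because \<open>c\<close> is
  odd.\<close>

lemma conj_el:
  "inv (el k f) \<otimes> el i e \<otimes> el k f =
    el (if e then (if f then c * (i - k) + k else i + (c - 1) * k) else (if f then c * i else i)) e"
  by (auto simp: inv_el el_mult algebra_simps)

lemma even_cong_iff:
  assumes "[i = j] (mod N)"
  shows "even i \<longleftrightarrow> even j"
proof -
  have "[i = j] (mod 2)" using assms even_N by (rule cong_dvd_modulus)
  then show ?thesis by (simp add: cong_def even_iff_mod_2_eq_zero)
qed

text \<open>For \<open>(p, q)\<close> other than \<open>(False, False)\<close> these are the three maximal subgroups,
  the kernels of the nontrivial homomorphisms to the group of order two.\<close>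

definition max_subgroup :: "bool \<Rightarrow> bool \<Rightarrow> 'a set" where
  "max_subgroup p q = {el i e | i e. (p \<and> odd i) = (q \<and> e)}"

lemma el_in_max_subgroup: "el i e \<in> max_subgroup p q \<longleftrightarrow> (p \<and> odd i) = (q \<and> e)"
proof
  assume "el i e \<in> max_subgroup p q"
  then obtain j f where "el i e = el j f" "(p \<and> odd j) = (q \<and> f)"
    unfolding max_subgroup_def by blast
  then show "(p \<and> odd i) = (q \<and> e)" using even_cong_iff[of i j] by (simp add: el_eq_iff)
qed (auto simp: max_subgroup_def)

lemma max_subgroup_normal: "max_subgroup p q \<lhd> G"
  unfolding normal_inv_iff
proof (intro conjI ballI)
  show "subgroup (max_subgroup p q) G"
  proof (rule subgroupI)
    show "max_subgroup p q \<noteq> {}" using el_in_max_subgroup[of 0 False] by auto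
    show "max_subgroup p q \<subseteq> carrier G" by (auto simp: max_subgroup_def)
  next
    fix x assume x: "x \<in> max_subgroup p q"
    then obtain i e where "x = el i e" unfolding max_subgroup_def by blast
    then show "inv x \<in> max_subgroup p q"
      using x odd_c by (auto simp: inv_el el_in_max_subgroup)
  next
    fix x y assume xy: "x \<in> max_subgroup p q" "y \<in> max_subgroup p q"
    then obtain i e j f where "x = el i e" "y = el j f" unfolding max_subgroup_def by blast
    then show "x \<otimes> y \<in> max_subgroup p q"
      using xy odd_c by (auto simp: el_mult el_in_max_subgroup)
  qed
  fix x h assume x: "x \<in> carrier G" and h: "h \<in> max_subgroup p q"
  obtain k f where kf: "inv x = el k f" using x by (meson carrierE inv_closed)
  obtain i e where ie: "h = el i e" using h unfolding max_subgroup_def by blast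
  have "x \<otimes> h \<otimes> inv x = inv (el k f) \<otimes> el i e \<otimes> el k f"
    using x by (simp add: ie flip: kf)
  then show "x \<otimes> h \<otimes> inv x \<in> max_subgroup p q"
    using h odd_c by (auto simp: ie conj_el el_in_max_subgroup)
qed

text \<open>Otherwise the normal subgroup \<open>max_subgroup p q\<close> would contain
  \<open>S\<close>, hence the whole group, but it misses \<open>a\<close> if \<open>p\<close> holds
  and \<open>b\<close> if not.\<close>

lemma normally_generates_obtain:
  assumes S: "normally_generates G S" and pq: "p \<or> q"
  obtains i e where "el i e \<in> S" "(p \<and> odd i) \<noteq> (q \<and> e)"
proof -
  have "\<not> S \<subseteq> max_subgroup p q"
  proof
    assume "S \<subseteq> max_subgroup p q"
    then have "carrier G \<subseteq> max_subgroup p q"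
      using S max_subgroup_normal unfolding normally_generates_def normal_closure_def by blast
    then have "el (if p then 1 else 0) (\<not> p) \<in> max_subgroup p q"
      by (rule subsetD) simp
    then show False using pq by (auto simp: el_in_max_subgroup split: if_splits)
  qed
  then obtain x where "x \<in> S" "x \<notin> max_subgroup p q" by blast
  moreover then obtain i e where "x = el i e"
    using S carrierE unfolding normally_generates_def by blast
  ultimately show ?thesis using that by (auto simp: el_in_max_subgroup)
qed

text \<open>Conjugating \<open>a\<^sup>i b\<close> by \<open>a\<^sup>k\<close> adds \<open>(c - 1) k\<close> to the exponent, and \<open>(c - 1) / 2 = 2\<^bsup>n-3\<^esup> - 1\<close> is
  invertible modulo \<open>2\<^bsup>n-2\<^esup>\<close>.\<close>

lemma reflection_in_Conj_pm:
  assumes "el i True \<in> S" "even (i - j)"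
  shows "el j True \<in> Conj_pm G S"
proof -
  obtain m where n_eq: "n = m + 4" using n by (metis add.commute le_Suc_ex)
  define d where "d = (2 :: int) ^ (n - 3) - 1"
  have c: "c - 1 = 2 * d" by (simp add: d_def sd_exp_def n_eq)
  have "odd d" using n by (simp add: d_def)
  then have "coprime d (2 ^ (n - 2))" by simp
  then obtain x where x: "[d * x = 1] (mod 2 ^ (n - 2))"
    using cong_solve_coprime_int by blast
  \<comment> \<open>With \<open>j = i + 2t\<close> and \<open>x\<close> inverse to \<open>d\<close>,
    conjugation by \<open>a^(xt)\<close> adds \<open>2dxt\<close>, which is \<open>2t\<close> modulo
    \<open>N\<close> after doubling the congruence.\<close>
  obtain t where t: "j = i + 2 * t" using assms(2) 
    by (metis add_diff_cancel_left' diff_add_cancel dvdE minus_diff_eq dvd_minus_iff)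
  have "[d * x * t = t] (mod 2 ^ (n - 2))" using cong_scalar_right[OF x, of t] by simp
  then have "2 ^ (n - 2) dvd d * x * t - t" by (simp add: cong_iff_dvd_diff)
  then have "2 * 2 ^ (n - 2) dvd 2 * (d * x * t - t)" by (intro mult_dvd_mono) auto
  then have "N dvd (i + (c - 1) * (x * t)) - j"
    by (simp only: c t) (simp add: n_eq power_add algebra_simps)
  then have "[i + (c - 1) * (x * t) = j] (mod N)" by (simp add: cong_iff_dvd_diff)
  then have "inv (el (x * t) False) \<otimes> el i True \<otimes> el (x * t) False = el j True"
    by (simp add: conj_el el_eq_iff)
  then show ?thesis
    using Conj_pmI[OF assms(1), of "el (x * t) False"] by simp
qed

lemma rotation_in_Conj_pm:
  assumes "el i False \<in> S" "[j = i] (mod N) \<or> [j = - i] (mod N) \<or> [j = c * i] (mod N) \<or> [j = - c * i] (mod N)"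
  shows "el j False \<in> Conj_pm G S"
proof -
  have "el i False \<in> Conj_pm G S" "el (c * i) False \<in> Conj_pm G S"
    using Conj_pmI[OF assms(1) el_closed el_closed, of 0 False] Conj_pmI[OF assms(1) el_closed el_closed, of 0 True]
    by (simp_all add: conj_el)
  moreover have "el (- i) False \<in> Conj_pm G S" "el (- c * i) False \<in> Conj_pm G S"
    using Conj_pm_invI[OF assms(1) el_closed el_closed, of 0 False] Conj_pm_invI[OF assms(1) el_closed el_closed, of 0 True]
    by (simp_all add: inv_el[of i False] conj_el)
  ultimately show ?thesis using assms(2) el_eq_iff by metis
qed

text \<open>\<open>b\<close> turns the second exponent \<open>i\<close> into \<open>c * i\<close>,
  which the first factor compensates.\<close>

lemma rotation_is_product:
  assumes "el i True \<in> Conj_pm G S" "el (j - c * i) True \<in> Conj_pm G S"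
  shows "is_product_of G (Conj_pm G S) 2 (el j False)"
proof -
  have "el j False = el (j - c * i) True \<otimes> el i True" by (simp add: el_mult)
  then show ?thesis using assms unfolding is_product_of_Conj_pm_2 by blast
qed

section \<open>Upper bound\<close>

lemma product_length_bound:
  assumes S: "normally_generates G S" and g: "g \<in> carrier G"
  shows "\<exists>k. is_product_of G (Conj_pm G S) k g \<and> k \<le> (if n = 4 then 2 else 3)"
proof -
  let ?C = "Conj_pm G S"
  have one_step: "is_product_of G ?C 1 x" if "x \<in> ?C" for x
    using that by (simp only: is_product_of_Conj_pm_1)
  \<comment> \<open>\<open>max_subgroup False True\<close> is the group of rotations, so
    \<open>S\<close> has a reflection.\<close>
  obtain i where i: "el i True \<in> S"
    using normally_generates_obtain[OF S, of False True] by auto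
  \<comment> \<open>This maximal subgroup contains \<open>el i True\<close>. An element outside it
    is a reflection of the other parity or an odd rotation.\<close>
  obtain i' e where i': "el i' e \<in> S" "odd i' \<noteq> (odd i \<and> e)"
    using normally_generates_obtain[OF S, of True "odd i"] by auto
  obtain j f where g_eq: "g = el j f" using g by (rule carrierE)
  have refl: "el k True \<in> ?C" if "even (i - k)" for k
    using i that by (rule reflection_in_Conj_pm)
  \<comment> \<open>Both factors \<open>el i True\<close> and \<open>el (k - c * i) True\<close>
    have exponents of the parity of \<open>i\<close>.\<close>
  have rot: "is_product_of G ?C 2 (el k False)" if "even k" for k
    using that odd_c by (intro rotation_is_product[of i] refl) auto
  show ?thesis
  proof (cases e)
    case True
    then have refl': "el k True \<in> ?C" for k
      using i' reflection_in_Conj_pm[of i' S k] refl[of k] by auto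
    have "\<exists>k\<le>2. is_product_of G ?C k g"
      using one_step[OF refl'[of j]] rotation_is_product[OF refl' refl', of j]
      by (cases f) (auto simp: g_eq intro: exI[of _ 1] exI[of _ 2])
    then show ?thesis by (auto intro: order_trans)
  next
    case False
    with i' have i': "el i' False \<in> S" "odd i'" by auto
    then have a: "el i' False \<in> ?C" by (auto intro: rotation_in_Conj_pm)
    have cons: "is_product_of G ?C (Suc k) (el j f)" if "is_product_of G ?C k (el (j - i') f)" for k j f
      using that a unfolding is_product_of_Suc by (auto simp: el_mult intro!: bexI[of _ "el i' False"])
    show ?thesis
    proof (cases f)
      case True
      have "\<exists>k\<le>2. is_product_of G ?C k g"
      proof (cases "even (i - j)")
        case True
        then show ?thesis using one_step[OF refl] \<open>f\<close> by (auto simp: g_eq intro!: exI[of _ 1])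
      next
        case False
        \<comment> \<open>Splitting off the odd rotation \<open>a^i'\<close> moves the reflection
          into the class of \<open>el i True\<close>.\<close>
        then have "el (j - i') True \<in> ?C" using i' by (intro refl) auto
        then show ?thesis using cons[OF one_step] \<open>f\<close>
          by (auto simp: g_eq numeral_2_eq_2 intro!: exI[of _ 2])
      qed
      then show ?thesis by (auto intro: order_trans)
    next
      case not_f: False
      show ?thesis
      proof (cases "even j")
        case True
        then show ?thesis using rot[of j] not_f by (auto simp: g_eq intro!: exI[of _ 2])
      next
        case odd_j: False
        show ?thesis
        proof (cases "n = 4")
          case True
          then have c: "c = 3" and N: "N = 8" by (simp_all add: sd_exp_def)
          \<comment> \<open>The odd residues modulo 8 are plus or minus 1 and plus or minus 3, so
            the four conjugates of an odd rotation and its inverse exhaust them.\<close>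
          have "[j = i'] (mod N) \<or> [j = - i'] (mod N) \<or> [j = c * i'] (mod N) \<or> [j = - c * i'] (mod N)"
          proof -
            define u v where "u = i' mod 8" and "v = j mod 8"
            have "u \<in> {1, 3, 5, 7}" "v \<in> {1, 3, 5, 7}"
              using odd_j i'(2) unfolding insert_iff empty_iff u_def v_def by presburger+
            moreover have red: "j mod 8 = v" "i' mod 8 = u" "- i' mod 8 = - u mod 8"
                "3 * i' mod 8 = 3 * u mod 8" "- 3 * i' mod 8 = - 3 * u mod 8"
              by (simp_all only: u_def v_def mod_minus_eq mod_mult_right_eq)
            ultimately show ?thesis unfolding c N cong_def red by (elim insertE emptyE) simp_all
          qed
          then have "el j False \<in> ?C" using i'(1) by (intro rotation_in_Conj_pm)
          then show ?thesis using one_step not_f True by (auto simp: g_eq intro!: exI[of _ 1])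
        next
          case False
          \<comment> \<open>\<open>j - i'\<close> is even, so one rotation and two reflections
            suffice.\<close>
          have "is_product_of G ?C 3 g"
            using cons[OF rot] odd_j i'(2) not_f by (simp add: g_eq numeral_3_eq_3 numeral_2_eq_2)
          then show ?thesis using False by auto
        qed
      qed
    qed
  qed
qed

lemma conj_norm_group_le:
  assumes "normally_generates G S"
  shows "conj_norm_group G S \<le> (if n = 4 then 2 else 3)"
  unfolding conj_norm_group_def
proof (rule SUP_least)
  fix g assume "g \<in> carrier G"
  then obtain k where k: "is_product_of G (Conj_pm G S) k g" "k \<le> (if n = 4 then 2 else 3)"
    using product_length_bound[OF assms] by blast
  have "conj_norm G S g \<le> (if n = 4 then 2 else 3)"
    using conj_norm_le[OF k(1)] k(2) by (rule order_trans)
  then show "enat (conj_norm G S g) \<le> (if n = 4 then 2 else 3)"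
    by (simp add: numeral_eq_enat split: if_splits)
qed

section \<open>Lower bound from the generators \<open>a\<close> and \<open>b\<close>\<close>

definition std_gens :: "'a set" where
  "std_gens = {el 1 False, el 0 True}"

lemma std_gens_normally_generate: "normally_generates G std_gens"
proof -
  have "carrier G \<subseteq> H" if H: "H \<lhd> G" "std_gens \<subseteq> H" for H
  proof
    interpret H: normal H G by (rule H(1))
    have a: "el 1 False \<in> H" and b: "el 0 True \<in> H" using H(2) by (auto simp: std_gens_def)
    have pow: "el (int k) False \<in> H" for k
    proof (induction k)
      case 0
      show ?case using H.one_closed by (simp add: one_eq)
    next
      case (Suc k)
      then show ?case using H.m_closed[OF Suc a] by (simp add: el_mult add.commute)
    qed
    fix x assume "x \<in> carrier G"
    then obtain i e where x: "x = el i e" by (rule carrierE)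
    \<comment> \<open>Reducing the exponent modulo \<open>N\<close> makes it nonnegative, so
      \<open>pow\<close> covers negative powers too.\<close>
    have "el i False = el (int (nat (i mod N))) False" by (simp add: el_eq_iff)
    then have "el i False \<in> H" using pow by metis
    moreover from H.m_closed[OF this b] have "el i True \<in> H" by (simp add: el_mult)
    ultimately show "x \<in> H" by (cases e) (simp_all add: x)
  qed
  then show ?thesis
    unfolding normally_generates_def normal_closure_def
    by (auto simp: std_gens_def normal_inv_iff subgroup_self)
qed

text \<open>Every element is conjugate under the rule \<open>conj_el\<close> to \<open>a\<close>,
  its inverse, or the involution \<open>b\<close>; the conditions are necessary and so rule out
  short products.\<close>

lemma el_Conj_pm_std_gens:
  assumes "el j e \<in> Conj_pm G std_gens"
  shows "if e then even j else [j = 1] (mod N) \<or> [j = - 1] (mod N) \<or> [j = c] (mod N) \<or> [j = - c] (mod N)"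
proof -
  obtain h s where hs: "el j e = inv h \<otimes> s \<otimes> h" "h \<in> carrier G" "s \<in> carrier G"
    "s \<in> std_gens \<or> inv s \<in> std_gens"
    using assms unfolding Conj_pm_def by blast
  obtain k f where h: "h = el k f" using hs(2) by (rule carrierE)
  have "s \<in> {el 1 False, el 0 True} \<or> s \<in> {inv (el 1 False), inv (el 0 True)}"
    using hs(4) inv_inv[OF hs(3)] unfolding std_gens_def by (metis empty_iff insert_iff)
  then have "s = el 1 False \<or> s = el (- 1) False \<or> s = el 0 True"
    by (auto simp: inv_el)
  then consider "s = el 1 False" | "s = el (- 1) False" | "s = el 0 True" by blast
  then show ?thesis
  proof cases
    case 3
    then have e: "e" and "[j = (if f then c * (0 - k) + k else (c - 1) * k)] (mod N)"
      using hs(1) by (auto simp: h conj_el el_eq_iff)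
    from even_cong_iff[OF this(2)] have "even j" using odd_c by (cases f) auto
    with e show ?thesis by simp
  qed (use hs(1) in \<open>cases f; simp add: h conj_el el_eq_iff\<close>)+
qed

text \<open>\<open>LEAST\<close> is informative only if some length works. The upper bound provides
  one, so the norm is itself a realised length.\<close>

lemma conj_norm_ge:
  assumes "x \<in> carrier G" "\<And>k. k < m \<Longrightarrow> \<not> is_product_of G (Conj_pm G std_gens) k x"
  shows "m \<le> conj_norm G std_gens x"
proof -
  obtain k where "is_product_of G (Conj_pm G std_gens) k x"
    using product_length_bound[OF std_gens_normally_generate assms(1)] by blast
  then have "is_product_of G (Conj_pm G std_gens) (conj_norm G std_gens x) x"
    unfolding conj_norm_def by (rule LeastI)
  then show ?thesis using assms(2) not_less by blast
qed

text \<open>\<open>a^2\<close> is not the identity, and conjugates of \<open>a\<close> and its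
  inverse have odd exponents.\<close>

lemma conj_norm_std_gens_a2: "2 \<le> conj_norm G std_gens (el 2 False)"
proof (rule conj_norm_ge)
  fix k :: nat assume "k < 2"
  have "8 dvd N" using le_imp_power_dvd[of 3 "n - 1" "2::int"] n by simp
  moreover have "\<not> 8 dvd (2 :: int)" by simp
  ultimately have N: "\<not> N dvd 2" using dvd_trans by blast
  have "el 2 False \<notin> Conj_pm G std_gens"
    using el_Conj_pm_std_gens[of 2 False] even_cong_iff[of 2 1] even_cong_iff[of 2 "- 1"]
      even_cong_iff[of 2 c] even_cong_iff[of 2 "- c"] odd_c by auto
  then show "\<not> is_product_of G (Conj_pm G std_gens) k (el 2 False)"
    using \<open>k < 2\<close> N is_product_of_Conj_pm_1
    by (auto simp: less_2_cases_iff is_product_of_0 one_eq el_eq_iff cong_iff_dvd_diff)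
qed simp

text \<open>Each allowed factor is an odd rotation or an even reflection, so it lies outside
  \<open>max_subgroup True True\<close>, of index two. A product of two factors therefore lies
  inside, while \<open>a^3\<close> does not.\<close>

lemma conj_norm_std_gens_a3:
  assumes "n \<ge> 5"
  shows "3 \<le> conj_norm G std_gens (el 3 False)"
proof (rule conj_norm_ge)
  fix k :: nat assume "k < 3"
  let ?C = "Conj_pm G std_gens"
  \<comment> \<open>As \<open>c\<close> is -1 modulo 8, the differences of 3 with 1, -1,
    \<open>c\<close>, \<open>-c\<close> are 2, 4, 4, 2 modulo 8, so none is divisible by 16. For
    \<open>n = 4\<close> this fails because \<open>c = 3\<close>.\<close>
  have "16 dvd N" using le_imp_power_dvd[of 4 "n - 1" "2::int"] assms by simp
  moreover have "8 dvd c + 1" using le_imp_power_dvd[of 3 "n - 2" "2::int"] assms by (simp add: sd_exp_def)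
  moreover from this have "\<not> 16 dvd 3 - c" "\<not> 16 dvd 3 - (- c)" by presburger+
  moreover have "\<not> 16 dvd 3 - (1 :: int)" "\<not> 16 dvd 3 - (- 1 :: int)" by simp_all
  ultimately have "\<not> ([3 = 1] (mod N) \<or> [3 = - 1] (mod N) \<or> [3 = c] (mod N) \<or> [3 = - c] (mod N))"
    unfolding cong_iff_dvd_diff using dvd_trans by metis
  then have not_C: "el 3 False \<notin> ?C"
    using el_Conj_pm_std_gens[of 3 False] by auto
  have prod: "\<exists>i e. x = el i e \<and> (odd i \<longleftrightarrow> \<not> e)" if x: "x \<in> ?C" for x
  proof -
    obtain i e where ie: "x = el i e" using x Conj_pm_closed carrierE by blast
    have "odd i \<longleftrightarrow> \<not> e"
      using el_Conj_pm_std_gens[of i e] x even_cong_iff[of i 1] even_cong_iff[of i "- 1"]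
        even_cong_iff[of i c] even_cong_iff[of i "- c"] odd_c
      by (cases e) (auto simp: ie)
    with ie show ?thesis by blast
  qed
  have "\<not> is_product_of G ?C 2 (el 3 False)"
  proof
    assume "is_product_of G ?C 2 (el 3 False)"
    then obtain x y where xy: "x \<in> ?C" "y \<in> ?C" "el 3 False = x \<otimes> y"
      unfolding is_product_of_Conj_pm_2 by blast
    obtain i e j f where x: "x = el i e" "odd i \<longleftrightarrow> \<not> e" and y: "y = el j f" "odd j \<longleftrightarrow> \<not> f"
      using prod xy by metis
    have eq: "[3 = i + (if e then c * j else j)] (mod N)" and "e = f"
      using xy(3) unfolding x(1) y(1) el_mult el_eq_iff by blast+
    from even_cong_iff[OF eq] have "odd (i + (if e then c * j else j))" by simp
    then show False using x(2) y(2) \<open>e = f\<close> odd_c by (cases e) auto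
  qed
  moreover have "\<not> is_product_of G ?C 1 (el 3 False)"
    using not_C is_product_of_Conj_pm_1 by blast
  moreover have "\<not> is_product_of G ?C 0 (el 3 False)"
    using even_cong_iff[of 3 0] by (auto simp: is_product_of_0 one_eq el_eq_iff)
  moreover have "k = 0 \<or> k = 1 \<or> k = 2" using \<open>k < 3\<close> by auto
  ultimately show "\<not> is_product_of G ?C k (el 3 False)" by blast
qed simp

end

theorem theorem1p4:
  fixes n :: nat
  assumes "n \<ge> 4"
  shows "conjugacy_diameter (SD n) = (if n = 4 then 2 else 3)"
proof -
  obtain el where "semidihedral (SD n) n el" using SD_semidihedral[OF assms] .
  then interpret semidihedral "SD n" n el .
  have le: "conjugacy_diameter (SD n) \<le> (if n = 4 then 2 else 3)"
    unfolding conjugacy_diameter_def by (intro SUP_least) (use conj_norm_group_le in auto)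
  have ge: "enat (conj_norm (SD n) std_gens x) \<le> conjugacy_diameter (SD n)" if "x \<in> carrier (SD n)" for x
  proof -
    have "enat (conj_norm (SD n) std_gens x) \<le> conj_norm_group (SD n) std_gens"
      unfolding conj_norm_group_def using that by (rule SUP_upper)
    also have "\<dots> \<le> conjugacy_diameter (SD n)"
      unfolding conjugacy_diameter_def
      by (rule SUP_upper) (simp add: std_gens_normally_generate, simp add: std_gens_def)
    finally show ?thesis .
  qed
  \<comment> \<open>The bound is attained by \<open>std_gens\<close> at \<open>a^2\<close> for
    \<open>n = 4\<close> and at \<open>a^3\<close> otherwise.\<close>
  have "(if n = 4 then 2 else 3) \<le> conjugacy_diameter (SD n)"
  proof (cases "n = 4")
    case True
    have "enat 2 \<le> enat (conj_norm (SD n) std_gens (el 2 False))"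
      using conj_norm_std_gens_a2 by simp
    also have "\<dots> \<le> conjugacy_diameter (SD n)" by (rule ge) simp
    finally show ?thesis using True by (simp add: numeral_eq_enat)
  next
    case False
    have "enat 3 \<le> enat (conj_norm (SD n) std_gens (el 3 False))"
      using conj_norm_std_gens_a3 assms False by simp
    also have "\<dots> \<le> conjugacy_diameter (SD n)" by (rule ge) simp
    finally show ?thesis using False by (simp add: numeral_eq_enat)
  qed
  with le show ?thesis by (rule antisym)
qed

end
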